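(* Let $$A=\begin{pmatrix} u&a&b\\ a&v&c\\ b&c&w\end{pmatrix},\qquad B=\begin{pmatrix} u&\alpha_1&\beta_2\\ \alpha_2&v&\gamma_1\\ \beta_1&\gamma_2&w\end{pmatrix}$$ be real matrices, where $\alpha_1\alpha_2=a^2$, $\beta_1\beta_2=b^2$ and $\gamma_1\gamma_2=c^2$. Suppose that $A\ge 0$. If $B^{-1}$ is an $M$-matrix then $A^{-1}$ is an $M$-matrix.
   Context: For a matrix $A$, $A\ge 0$ means that all entries of $A$ are nonnegative. A real square matrix $M=\{m_{i,j}\}$ is an $M$-matrix if (1) $m_{i,j}\le 0$ for all $i\ne j$, and (2) $M$ is nonsingular and $M^{-1}\ge 0$ (entrywise). The hypothesis "$B^{-1}$ is an $M$-matrix" includes that $B$ is invertible; the conclusion "$A^{-1}$ is an $M$-matrix" includes that $A$ is invertible. *)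

theory Defs
  imports "HOL-Analysis.Analysis"
begin

text \<open>The order on \<open>real ^ 'n ^ 'n\<close> is the componentwise one, so \<open>0 \<le> A\<close> says that all
  entries of \<open>A\<close> are nonnegative.\<close>

definition M_matrix :: "real ^ 'n ^ 'n \<Rightarrow> bool" where
  "M_matrix M \<longleftrightarrow>
     (\<forall>i j. i \<noteq> j \<longrightarrow> M $ i $ j \<le> 0) \<and> invertible M \<and> 0 \<le> matrix_inv M"

end

theory Submission
  imports Defs
begin

text \<open>Off-diagonal signs of \<open>B\<inverse>\<close> are inequalities such as \<open>\<beta>\<^sub>2 \<gamma>\<^sub>2 \<le> \<alpha>\<^sub>1 w\<close> and
  \<open>\<beta>\<^sub>1 \<gamma>\<^sub>1 \<le> \<alpha>\<^sub>2 w\<close>; their product is \<open>(b c)\<^sup>2 \<le> (a w)\<^sup>2\<close>, which is the sign condition for \<open>A\<close>.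
  The diagonal entries and the principal \<open>2 \<times> 2\<close> minors of \<open>A\<close> and \<open>B\<close> agree, so they are
  positive (\<open>det B > 0\<close>, as \<open>w / det B\<close> is a principal minor of \<open>B\<inverse>\<close>). Since \<open>det A \<le> det B\<close> by AM-GM, positivity of \<open>det A\<close> is not inherited from \<open>B\<close>.
  It follows from the sign conditions instead: after scaling the diagonal to 1, let \<open>z\<close>
  be the smallest of the off-diagonal entries \<open>x, y, z\<close>; then
  \<open>0 \<le> z - x y \<le> min (x (1 - y)) (y (1 - x))\<close>, so
  \<open>(z - x y)\<^sup>2 < (1 - x\<^sup>2) (1 - y\<^sup>2)\<close>.\<close>

lemma matrix_inv:
  assumes "invertible A"
  shows "A ** matrix_inv A = mat 1" and "matrix_inv A ** A = mat 1"
  using someI_ex[OF assms[unfolded invertible_def]] by (simp_all add: matrix_inv_def)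

lemma invertible_matrix_inv: "invertible A \<Longrightarrow> invertible (matrix_inv A)"
  unfolding invertible_def[of "matrix_inv A"] using matrix_inv by blast

lemma matrix_inv_matrix_inv:
  assumes "invertible A"
  shows "matrix_inv (matrix_inv A) = A"
proof -
  have "matrix_inv (matrix_inv A) = (A ** matrix_inv A) ** matrix_inv (matrix_inv A)"
    using assms by (simp add: matrix_inv)
  also have "\<dots> = A ** (matrix_inv A ** matrix_inv (matrix_inv A))"
    by (rule matrix_mul_assoc[symmetric])
  also have "\<dots> = A"
    using assms by (simp only: matrix_inv invertible_matrix_inv matrix_mul_rid)
  finally show ?thesis .
qed

text \<open>In the diagonal entry of \<open>M ** N = mat 1\<close> every off-diagonal term is
  nonpositive, so \<open>M $ i $ i * N $ i $ i\<close> is at least 1; since \<open>N $ i $ i\<close>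
  is nonnegative, both factors are positive.\<close>

lemma M_matrix_diag_pos:
  assumes "M_matrix M"
  shows "0 < M $ i $ i" and "0 < matrix_inv M $ i $ i"
proof -
  define N where "N = matrix_inv M"
  have off: "M $ i $ k \<le> 0" if "k \<noteq> i" for k
    using assms that by (auto simp: M_matrix_def)
  have N: "0 \<le> N $ k $ l" for k l
    using assms by (auto simp: M_matrix_def N_def less_eq_vec_def)
  have "M ** N = mat 1"
    using assms by (simp add: M_matrix_def N_def matrix_inv)
  then have "(M ** N) $ i $ i = 1"
    by (simp add: mat_def)
  then have "1 = (\<Sum>k\<in>UNIV. M $ i $ k * N $ k $ i)"
    by (simp add: matrix_matrix_mult_def)
  also have "\<dots> = M $ i $ i * N $ i $ i + (\<Sum>k\<in>UNIV - {i}. M $ i $ k * N $ k $ i)"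
    by (subst sum.remove[of UNIV i]) auto
  also have "(\<Sum>k\<in>UNIV - {i}. M $ i $ k * N $ k $ i) \<le> 0"
    using off N by (intro sum_nonpos mult_nonpos_nonneg) auto
  finally have "0 < M $ i $ i * N $ i $ i"
    by simp
  then show "0 < M $ i $ i" "0 < matrix_inv M $ i $ i"
    using N[of i i] by (auto simp: zero_less_mult_iff N_def)
qed

text \<open>The positive vector \<open>x = M\<inverse> 1\<close> makes \<open>M\<close> with columns scaled by \<open>x\<close> strictly diagonally
  dominant.\<close>

lemma M_matrix_minor_pos:
  assumes M: "M_matrix M" and "i \<noteq> j"
  shows "M $ i $ j * M $ j $ i < M $ i $ i * M $ j $ j"
proof -
  define N where "N = matrix_inv M"
  define x where "x = N *v (\<chi> k. 1)"
  have N: "0 \<le> N $ k $ l" for k l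
    using M by (auto simp: M_matrix_def N_def less_eq_vec_def)
  have x: "0 < x $ k" for k
  proof -
    have "0 < N $ k $ k"
      using M_matrix_diag_pos[OF M] by (simp add: N_def)
    also have "\<dots> \<le> (\<Sum>l\<in>UNIV. N $ k $ l)"
      by (rule member_le_sum) (auto simp: N)
    finally show ?thesis
      by (simp add: x_def matrix_vector_mult_def)
  qed
  have Mx: "M *v x = (\<chi> k. 1)"
    using M by (simp add: x_def N_def M_matrix_def matrix_inv matrix_vector_mul_assoc)
  have dom: "- M $ k $ l * x $ l < M $ k $ k * x $ k" if "k \<noteq> l" for k l
  proof -
    have "1 = (\<Sum>m\<in>UNIV. M $ k $ m * x $ m)"
      using Mx by (simp add: vec_eq_iff matrix_vector_mult_def)
    also have "\<dots> = M $ k $ k * x $ k + (M $ k $ l * x $ l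
        + (\<Sum>m\<in>UNIV - {k} - {l}. M $ k $ m * x $ m))"
      using that by (simp add: sum.remove[of UNIV k] sum.remove[of "UNIV - {k}" l])
    also have "(\<Sum>m\<in>UNIV - {k} - {l}. M $ k $ m * x $ m) \<le> 0"
      using M x by (intro sum_nonpos mult_nonpos_nonneg) (auto simp: M_matrix_def less_imp_le)
    finally show ?thesis
      by simp
  qed
  \<comment> \<open>Multiply the dominance inequalities of rows \<open>i\<close> and
    \<open>j\<close>. The two minus signs cancel, and so does the positive factor
    \<open>x $ i * x $ j\<close>.\<close>
  have "(- M $ i $ j * x $ j) * (- M $ j $ i * x $ i) < (M $ i $ i * x $ i) * (M $ j $ j * x $ j)"
    using \<open>i \<noteq> j\<close> M x
    by (intro mult_strict_mono' dom mult_nonneg_nonneg) (auto simp: M_matrix_def less_imp_le)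
  then have "(M $ i $ j * M $ j $ i) * (x $ i * x $ j) < (M $ i $ i * M $ j $ j) * (x $ i * x $ j)"
    by (simp add: mult_ac)
  then show ?thesis
    using x[of i] x[of j] by (simp add: mult_less_cancel_right)
qed

definition adjugate3 :: "'a::comm_ring_1 ^ 3 ^ 3 \<Rightarrow> 'a ^ 3 ^ 3" where
  "adjugate3 A = vector
     [vector [A$2$2 * A$3$3 - A$2$3 * A$3$2, A$1$3 * A$3$2 - A$1$2 * A$3$3, A$1$2 * A$2$3 - A$1$3 * A$2$2],
      vector [A$2$3 * A$3$1 - A$2$1 * A$3$3, A$1$1 * A$3$3 - A$1$3 * A$3$1, A$1$3 * A$2$1 - A$1$1 * A$2$3],
      vector [A$2$1 * A$3$2 - A$2$2 * A$3$1, A$1$2 * A$3$1 - A$1$1 * A$3$2, A$1$1 * A$2$2 - A$1$2 * A$2$1]]"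

lemma adjugate3_mult: "adjugate3 A ** A = mat (det A)"
  by (simp add: vec_eq_iff forall_3 matrix_matrix_mult_def sum_3 mat_def det_3 adjugate3_def
      algebra_simps)

lemma matrix_inv_3:
  fixes A :: "'a::field ^ 3 ^ 3"
  assumes "invertible A"
  shows "matrix_inv A $ i $ j = adjugate3 A $ i $ j / det A"
proof -
  have "adjugate3 A = mat (det A) ** matrix_inv A"
    using assms by (simp flip: adjugate3_mult matrix_mul_assoc add: matrix_inv)
  then have "adjugate3 A $ i $ j = (mat (det A) ** matrix_inv A) $ i $ j"
    by simp
  also have "\<dots> = det A * matrix_inv A $ i $ j"
    by (simp add: matrix_matrix_mult_def mat_def if_distrib if_distribR sum.delta' cong: if_cong)
  finally show ?thesis
    using assms by (simp add: invertible_det_nz)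
qed

text \<open>The expression is the determinant of the symmetric matrix with unit diagonal and
  off-diagonal entries \<open>x\<close>, \<open>y\<close>, \<open>z\<close>. It equals
  \<open>(1 - x^2) * (1 - y^2) - (z - x * y)^2\<close>.\<close>

lemma unit_diag_det_pos:
  fixes x y z :: real
  assumes "0 \<le> x" "0 \<le> y" "0 \<le> z" "x < 1" "y < 1" "z < 1"
    and "y * z \<le> x" "x * z \<le> y" "x * y \<le> z"
  shows "0 < 1 + 2 * x * y * z - x\<^sup>2 - y\<^sup>2 - z\<^sup>2"
proof -
  have smallest: "0 < 1 + 2 * p * q * r - p\<^sup>2 - q\<^sup>2 - r\<^sup>2"
    if "0 \<le> p" "0 \<le> q" "p < 1" "q < 1" "p * q \<le> r" "r \<le> p" "r \<le> q" for p q r :: real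
  proof -
    \<comment> \<open>The bounds \<open>r \<le> p\<close> and \<open>r \<le> q\<close> each estimate
      one factor of the square.\<close>
    have "(r - p * q)\<^sup>2 \<le> (p * (1 - q)) * (q * (1 - p))"
      unfolding power2_eq_square using that by (intro mult_mono) (auto simp: algebra_simps)
    also have "\<dots> = (p * q) * ((1 - p) * (1 - q))"
      by (simp add: mult_ac)
    also have "\<dots> < ((1 + p) * (1 + q)) * ((1 - p) * (1 - q))"
      using that by (intro mult_strict_right_mono mult_pos_pos) (simp_all add: algebra_simps)
    finally show ?thesis
      by (simp add: algebra_simps power2_eq_square)
  qed
  \<comment> \<open>The claim is symmetric in \<open>x\<close>, \<open>y\<close>, \<open>z\<close>,
    so whichever is smallest can play the role of \<open>r\<close>.\<close>
  consider "z \<le> x" "z \<le> y" | "x \<le> y" "x \<le> z" | "y \<le> x" "y \<le> z"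
    by linarith
  then show ?thesis
    using smallest[of x y z] smallest[of y z x] smallest[of x z y] assms
    by cases (simp_all add: mult_ac)
qed

text \<open>Dividing rows and columns by the square roots of the diagonal entries reduces this to
  \<open>unit_diag_det_pos\<close>: the minors become \<open>x, y, z < 1\<close>, the sign
  conditions keep their form, and the determinant is divided by \<open>u * v * w\<close>.\<close>

lemma symmetric_det_pos:
  fixes u v w a b c :: real
  assumes pos: "0 < u" "0 < v" "0 < w" and nonneg: "0 \<le> a" "0 \<le> b" "0 \<le> c"
    and minors: "a\<^sup>2 < u * v" "b\<^sup>2 < u * w" "c\<^sup>2 < v * w"
    and signs: "b * c \<le> a * w" "a * c \<le> b * v" "a * b \<le> c * u"
  shows "0 < u * v * w + 2 * a * b * c - v * b\<^sup>2 - w * a\<^sup>2 - u * c\<^sup>2"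
proof -
  define p q r where "p = sqrt u" and "q = sqrt v" and "r = sqrt w"
  have pqr [simp]: "0 < p" "0 < q" "0 < r" and uvw: "u = p\<^sup>2" "v = q\<^sup>2" "w = r\<^sup>2"
    using pos by (simp_all add: p_def q_def r_def)
  have [simp]: "p \<noteq> 0" "q \<noteq> 0" "r \<noteq> 0"
    using pqr[THEN less_imp_neq] by simp_all
  define x y z where "x = a / (p * q)" and "y = b / (p * r)" and "z = c / (q * r)"
  have abc: "a = x * (p * q)" "b = y * (p * r)" "c = z * (q * r)"
    by (simp_all add: x_def y_def z_def)
  have lt1: "s < 1" if "(s * t)\<^sup>2 < t\<^sup>2" "0 < t" for s t :: real
  proof -
    have "s * t < t"
      using that by (intro power2_less_imp_less[of "s * t" t]) auto
    then show ?thesis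
      using that by simp
  qed
  have "x < 1" "y < 1" "z < 1"
    using minors lt1[of x "p * q"] lt1[of y "p * r"] lt1[of z "q * r"]
    by (simp_all add: abc uvw power_mult_distrib)
  moreover have "0 \<le> x" "0 \<le> y" "0 \<le> z"
    using nonneg pqr[THEN less_imp_le] by (simp_all add: x_def y_def z_def)
  moreover have "y * z \<le> x"
  proof -
    have "(y * z) * (p * q * r\<^sup>2) \<le> x * (p * q * r\<^sup>2)"
      using signs(1) by (simp add: abc uvw power2_eq_square mult_ac)
    then show ?thesis
      by (rule mult_right_le_imp_le) (simp add: zero_less_mult_iff)
  qed
  moreover have "x * z \<le> y"
  proof -
    have "(x * z) * (p * r * q\<^sup>2) \<le> y * (p * r * q\<^sup>2)"
      using signs(2) by (simp add: abc uvw power2_eq_square mult_ac)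
    then show ?thesis
      by (rule mult_right_le_imp_le) (simp add: zero_less_mult_iff)
  qed
  moreover have "x * y \<le> z"
  proof -
    have "(x * y) * (q * r * p\<^sup>2) \<le> z * (q * r * p\<^sup>2)"
      using signs(3) by (simp add: abc uvw power2_eq_square mult_ac)
    then show ?thesis
      by (rule mult_right_le_imp_le) (simp add: zero_less_mult_iff)
  qed
  ultimately have "0 < (p * q * r)\<^sup>2 * (1 + 2 * x * y * z - x\<^sup>2 - y\<^sup>2 - z\<^sup>2)"
    by (intro mult_pos_pos unit_diag_det_pos) auto
  also have "\<dots> = u * v * w + 2 * a * b * c - v * b\<^sup>2 - w * a\<^sup>2 - u * c\<^sup>2"
    by (simp add: abc uvw power2_eq_square algebra_simps)
  finally show ?thesis .
qed

text \<open>The factors of the two left-hand sides regroup into \<open>b^2 * c^2\<close>, those of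
  the right-hand sides into \<open>a^2 * w^2\<close>.\<close>

lemma mult_le_of_paired_mult_le:
  fixes a b c w :: real
  assumes "p' * q' \<le> p * w" "q * r \<le> s * w" "0 \<le> p' * q'" "0 \<le> q * r"
    and "p * s = a\<^sup>2" "p' * q = b\<^sup>2" "q' * r = c\<^sup>2" "0 \<le> a" "0 \<le> w"
  shows "b * c \<le> a * w"
proof (rule power2_le_imp_le)
  have "(b * c)\<^sup>2 = (p' * q') * (q * r)"
    using assms(6,7) by (simp add: power_mult_distrib flip: assms(6,7))
  also have "\<dots> \<le> (p * w) * (s * w)"
    using assms by (intro mult_mono[of "p' * q'"]) auto
  also have "\<dots> = (a * w)\<^sup>2"
    by (simp add: power_mult_distrib power2_eq_square[of w] mult_ac flip: assms(5))
  finally show "(b * c)\<^sup>2 \<le> (a * w)\<^sup>2" .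
qed (use assms in simp)

theorem lemma4p3:
  fixes u v w a b c \<alpha>\<^sub>1 \<alpha>\<^sub>2 \<beta>\<^sub>1 \<beta>\<^sub>2 \<gamma>\<^sub>1 \<gamma>\<^sub>2 :: real
    and A B :: "real ^ 3 ^ 3"
  assumes A_def: "A = vector [vector [u, a, b],
                              vector [a, v, c],
                              vector [b, c, w]]"
    and B_def: "B = vector [vector [u, \<alpha>\<^sub>1, \<beta>\<^sub>2],
                            vector [\<alpha>\<^sub>2, v, \<gamma>\<^sub>1],
                            vector [\<beta>\<^sub>1, \<gamma>\<^sub>2, w]]"
    and "\<alpha>\<^sub>1 * \<alpha>\<^sub>2 = a\<^sup>2" and "\<beta>\<^sub>1 * \<beta>\<^sub>2 = b\<^sup>2" and "\<gamma>\<^sub>1 * \<gamma>\<^sub>2 = c\<^sup>2"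
    and "0 \<le> A"
    and "invertible B" and "M_matrix (matrix_inv B)"
  shows "invertible A \<and> M_matrix (matrix_inv A)"
proof -
  note prods = \<open>\<alpha>\<^sub>1 * \<alpha>\<^sub>2 = a\<^sup>2\<close> \<open>\<beta>\<^sub>1 * \<beta>\<^sub>2 = b\<^sup>2\<close> \<open>\<gamma>\<^sub>1 * \<gamma>\<^sub>2 = c\<^sup>2\<close>
  note M = \<open>M_matrix (matrix_inv B)\<close>
  have BB: "matrix_inv (matrix_inv B) = B"
    using \<open>invertible B\<close> by (rule matrix_inv_matrix_inv)
  have B: "0 \<le> B"
    using M by (simp add: M_matrix_def BB)
  have B_nonneg: "0 \<le> \<alpha>\<^sub>1" "0 \<le> \<alpha>\<^sub>2" "0 \<le> \<beta>\<^sub>1" "0 \<le> \<beta>\<^sub>2" "0 \<le> \<gamma>\<^sub>1" "0 \<le> \<gamma>\<^sub>2"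
    using B by (simp_all add: less_eq_vec_def forall_3 B_def)
  have nonneg: "0 \<le> a" "0 \<le> b" "0 \<le> c"
    using \<open>0 \<le> A\<close> by (simp_all add: less_eq_vec_def forall_3 A_def)
  have pos: "0 < u" "0 < v" "0 < w"
    using M_matrix_diag_pos(2)[OF M, of 1] M_matrix_diag_pos(2)[OF M, of 2]
      M_matrix_diag_pos(2)[OF M, of 3] unfolding BB by (simp_all add: B_def)
  define d where "d = det B"
  have d0: "d \<noteq> 0"
    using \<open>invertible B\<close> by (simp add: d_def invertible_det_nz)
  have d_eq: "d = u * v * w + \<alpha>\<^sub>1 * \<gamma>\<^sub>1 * \<beta>\<^sub>1 + \<beta>\<^sub>2 * \<alpha>\<^sub>2 * \<gamma>\<^sub>2
      - u * \<gamma>\<^sub>1 * \<gamma>\<^sub>2 - \<alpha>\<^sub>1 * \<alpha>\<^sub>2 * w - \<beta>\<^sub>2 * v * \<beta>\<^sub>1"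
    by (simp add: d_def det_3 B_def)
  note inv = matrix_inv_3[OF \<open>invertible B\<close>, folded d_def]
  \<comment> \<open>Jacobi's identity: a principal minor of the inverse is the complementary entry
    \<open>w\<close> over the determinant.\<close>
  have "matrix_inv B $ 1 $ 1 * matrix_inv B $ 2 $ 2 - matrix_inv B $ 1 $ 2 * matrix_inv B $ 2 $ 1
      = (d * w) / (d * d)"
    unfolding inv d_eq by (simp add: adjugate3_def B_def field_simps flip: diff_divide_distrib)
  then have "0 < w / d"
    using M_matrix_minor_pos[OF M, of 1 2] d0 by simp
  then have d: "0 < d"
    using pos by (simp add: zero_less_divide_iff)
  \<comment> \<open>The diagonal entries of the inverse are principal minors of \<open>B\<close>
    over \<open>d\<close>; \<open>prods\<close> turns them into minors of \<open>A\<close>.\<close>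
  have minors: "a\<^sup>2 < u * v" "b\<^sup>2 < u * w" "c\<^sup>2 < v * w"
    using M_matrix_diag_pos(1)[OF M, of 1] M_matrix_diag_pos(1)[OF M, of 2]
      M_matrix_diag_pos(1)[OF M, of 3] d
    unfolding inv by (simp_all add: adjugate3_def B_def zero_less_divide_iff mult_ac flip: prods)
  have off: "adjugate3 B $ i $ j \<le> 0" if "i \<noteq> j" for i j
    using M that d by (auto simp: M_matrix_def inv divide_le_0_iff)
  have B_signs: "\<beta>\<^sub>2 * \<gamma>\<^sub>2 \<le> \<alpha>\<^sub>1 * w" "\<beta>\<^sub>1 * \<gamma>\<^sub>1 \<le> \<alpha>\<^sub>2 * w" "\<alpha>\<^sub>1 * \<gamma>\<^sub>1 \<le> \<beta>\<^sub>2 * v"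
    "\<alpha>\<^sub>2 * \<gamma>\<^sub>2 \<le> \<beta>\<^sub>1 * v" "\<alpha>\<^sub>2 * \<beta>\<^sub>2 \<le> \<gamma>\<^sub>1 * u" "\<alpha>\<^sub>1 * \<beta>\<^sub>1 \<le> \<gamma>\<^sub>2 * u"
    using off[of 1 2] off[of 2 1] off[of 1 3] off[of 3 1] off[of 2 3] off[of 3 2]
    by (simp_all add: adjugate3_def B_def mult_ac)
  \<comment> \<open>Each pair of inequalities comes from transposed positions of the adjugate of
    \<open>B\<close>.\<close>
  have 1: "b * c \<le> a * w"
    by (rule mult_le_of_paired_mult_le[OF B_signs(1,2)])
      (use B_nonneg prods pos nonneg in \<open>simp_all add: mult.commute\<close>)
  have 2: "a * c \<le> b * v"
    by (rule mult_le_of_paired_mult_le[OF B_signs(3,4)])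
      (use B_nonneg prods pos nonneg in \<open>simp_all add: mult.commute\<close>)
  have 3: "a * b \<le> c * u"
    by (rule mult_le_of_paired_mult_le[OF B_signs(5,6)])
      (use B_nonneg prods pos nonneg in \<open>simp_all add: mult.commute\<close>)
  have det_eq: "det A = u * v * w + 2 * a * b * c - v * b\<^sup>2 - w * a\<^sup>2 - u * c\<^sup>2"
    by (simp add: A_def det_3 power2_eq_square algebra_simps)
  have det: "0 < det A"
    unfolding det_eq by (rule symmetric_det_pos[OF pos nonneg minors 1 2 3])
  then have inv_A: "invertible A"
    by (simp add: invertible_det_nz)
  have "matrix_inv A $ i $ j \<le> 0" if "i \<noteq> j" for i j
  proof -
    \<comment> \<open>By symmetry of \<open>A\<close> there are only three distinct off-diagonal
      cofactors: \<open>b * c - a * w\<close>, \<open>a * c - b * v\<close> and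
      \<open>a * b - c * u\<close>.\<close>
    have "adjugate3 A $ i $ j \<le> 0"
      using 1 2 3 that exhaust_3[of i] exhaust_3[of j]
      by (auto simp: adjugate3_def A_def mult_ac)
    then show ?thesis
      using det by (simp add: matrix_inv_3[OF inv_A] divide_le_0_iff)
  qed
  then show ?thesis
    using inv_A \<open>0 \<le> A\<close> by (simp add: M_matrix_def matrix_inv_matrix_inv invertible_matrix_inv)
qed

end
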